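(* Let $D\subseteq\mathbb{R}$ be an interval with nonempty interior and $T>0$. Let $u\in C^1([0,T];C^2(D))$ be a given function which, for some $\alpha,\kappa\in C^1(D)$, satisfies $$\frac{\partial}{\partial t}u(t,x)+\frac{\partial}{\partial x}\Big(\alpha(x)u(t,x)\Big)-\frac{\partial}{\partial x}\Big(\kappa(x)\frac{\partial}{\partial x}u(t,x)\Big)=0,\qquad \forall (t,x)\in[0,T]\times D. \quad (\ast)$$ If there exist no nonempty open interval $\Omega\subseteq D$ and nonempty open interval $(T_1,T_2)\subseteq(0,T]$ such that $u(t,x)$ is weakly separable on $(T_1,T_2)\times\Omega$, then the functions $\alpha$ and $\kappa$ are unique, i.e. $(\alpha,\kappa)$ is the only pair of functions in $C^1(D)$ for which $(\ast)$ holds with the given $u$.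
   Context: A $C^1$ function $h$ of two variables $(t,x)\in(T_1,T_2)\times\Omega$ is called weakly separable on $(T_1,T_2)\times\Omega$ if there exist $f_1,f_2\in C^1(T_1,T_2)$ and $g_1,g_2\in C^1(\Omega)$ such that $h(t,x)=f_1(t)g_1(x)+f_2(t)g_2(x)$ for all $(t,x)\in(T_1,T_2)\times\Omega$. $C^1([0,T];C^2(D))$ denotes the functions $u(t,x)$ for which $t\mapsto u(t,\cdot)$ is a continuously differentiable map from $[0,T]$ into $C^2(D)$. *)

theory Defs
  imports "HOL-Analysis.Analysis"
begin

text \<open>
  Derivatives are taken relative to the domain \<open>S\<close>, so that they are one-sided at those
  endpoints of an interval that belong to it. The value is only meaningful where \<open>f\<close> is
  differentiable within \<open>S\<close>; \<open>(D_within S ^^ i) f\<close> is the \<open>i\<close>-th derivative on \<open>S\<close>.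
\<close>

definition D_within :: "real set \<Rightarrow> (real \<Rightarrow> real) \<Rightarrow> real \<Rightarrow> real" where
  "D_within S f x = vector_derivative f (at x within S)"

fun C_k_on :: "nat \<Rightarrow> real set \<Rightarrow> (real \<Rightarrow> real) \<Rightarrow> bool" where
  "C_k_on 0 S f \<longleftrightarrow> continuous_on S f"
| "C_k_on (Suc k) S f \<longleftrightarrow> f differentiable_on S \<and> C_k_on k S (D_within S f)"

text \<open>The library notion of a \<open>C\<^sup>1\<close> function uses two-sided derivatives.\<close>

lemma C_1_on_open_iff:
  assumes "open S"
  shows "C_k_on 1 S f \<longleftrightarrow> f C1_differentiable_on S"
proof -
  have "continuous_on S (D_within S f) \<longleftrightarrow> continuous_on S (\<lambda>x. vector_derivative f (at x))"
    by (rule continuous_on_cong) (simp_all add: D_within_def at_within_open[OF _ assms])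
  moreover have "f differentiable_on S \<longleftrightarrow> (\<forall>x\<in>S. f differentiable at x)"
    using assms by (simp add: differentiable_on_eq_differentiable_at)
  ultimately show ?thesis
    by (simp add: C1_differentiable_on_eq)
qed

definition C_1_on_2 :: "(real \<times> real) set \<Rightarrow> (real \<Rightarrow> real \<Rightarrow> real) \<Rightarrow> bool" where
  "C_1_on_2 A h \<longleftrightarrow>
    (\<exists>ht hx. continuous_on A ht \<and> continuous_on A hx \<and>
      (\<forall>p\<in>A. ((\<lambda>(t, x). h t x) has_derivative (\<lambda>(s, y). ht p * s + hx p * y)) (at p within A)))"

definition weakly_separable ::
    "(real \<Rightarrow> real \<Rightarrow> real) \<Rightarrow> real \<Rightarrow> real \<Rightarrow> real set \<Rightarrow> bool" where
  "weakly_separable h T1 T2 \<Omega> \<longleftrightarrow>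
    C_1_on_2 ({T1<..<T2} \<times> \<Omega>) h \<and>
    (\<exists>f1 f2 g1 g2.
      C_k_on 1 {T1<..<T2} f1 \<and> C_k_on 1 {T1<..<T2} f2 \<and> C_k_on 1 \<Omega> g1 \<and> C_k_on 1 \<Omega> g2 \<and>
      (\<forall>t\<in>{T1<..<T2}. \<forall>x\<in>\<Omega>. h t x = f1 t * g1 x + f2 t * g2 x))"

text \<open>
  Convergence in \<open>C\<^sup>2(S)\<close>: uniform convergence on compact subsets of \<open>S\<close> of the derivatives up to
  order two. If \<open>S\<close> is compact, this is convergence in the usual \<open>C\<^sup>2\<close> norm; in general it is
  implied by convergence in the \<open>C\<^sup>2\<close> norm taken over all of \<open>S\<close>.
\<close>

definition tendsto_C2 ::
    "real set \<Rightarrow> ('a \<Rightarrow> real \<Rightarrow> real) \<Rightarrow> (real \<Rightarrow> real) \<Rightarrow> 'a filter \<Rightarrow> bool" where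
  "tendsto_C2 S f g F \<longleftrightarrow>
    (\<forall>K. compact K \<and> K \<subseteq> S \<longrightarrow>
      (\<forall>i\<le>2. uniform_limit K (\<lambda>s. (D_within S ^^ i) (f s)) ((D_within S ^^ i) g) F))"

text \<open>
  The class \<open>C\<^sup>1(I; C\<^sup>2(S))\<close>; \<open>v\<close> is the derivative of the curve \<open>t \<mapsto> u(t, \<cdot>)\<close> in \<open>C\<^sup>2(S)\<close>.
\<close>

definition C1_into_C2 :: "real set \<Rightarrow> real set \<Rightarrow> (real \<Rightarrow> real \<Rightarrow> real) \<Rightarrow> bool" where
  "C1_into_C2 I S u \<longleftrightarrow>
    (\<forall>t\<in>I. C_k_on 2 S (u t)) \<and>
    (\<exists>v. \<forall>t\<in>I. C_k_on 2 S (v t) \<and>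
      tendsto_C2 S (\<lambda>s x. (u s x - u t x) / (s - t)) (v t) (at t within I) \<and>
      tendsto_C2 S v (v t) (at t within I))"

definition advection_diffusion ::
    "real \<Rightarrow> real set \<Rightarrow> (real \<Rightarrow> real \<Rightarrow> real) \<Rightarrow> (real \<Rightarrow> real) \<Rightarrow> (real \<Rightarrow> real) \<Rightarrow> bool" where
  "advection_diffusion T S u \<alpha> \<kappa> \<longleftrightarrow>
    (\<forall>t\<in>{0..T}. \<forall>x\<in>S.
      D_within {0..T} (\<lambda>s. u s x) t
        + D_within S (\<lambda>y. \<alpha> y * u t y) x
        - D_within S (\<lambda>y. \<kappa> y * D_within S (u t) y) x = 0)"

end

theory Submission
  imports Defs
begin

text \<open>
  For two coefficient pairs with differences \<open>a\<close> and \<open>k\<close>, subtracting the equations gives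
  \<open>\<partial>\<^sub>x (a u - k \<partial>\<^sub>x u) = 0\<close>, so \<open>a u - k \<partial>\<^sub>x u = c(t)\<close>. Where \<open>k \<noteq> 0\<close> this is a linear first-order
  equation in \<open>x\<close>; an integrating factor \<open>g\<close> that is independent of \<open>t\<close> turns it into
  \<open>u = f(t) g(x) - c(t) h(x) g(x)\<close>. Where \<open>k\<close> vanishes identically and \<open>a \<noteq> 0\<close>, it reads \<open>u = c(t) / a(x)\<close>.
  Both are weakly separable, so \<open>a\<close> and \<open>k\<close> vanish on the interior of \<open>D\<close>, hence by continuity on \<open>D\<close>.
\<close>

section \<open>Joint regularity of separable functions\<close>

text \<open>Weak separability includes the joint regularity \<open>C_1_on_2\<close>. Composing each
  factor with a projection and applying the product rule provides it for a single term.\<close>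

lemma C_1_on_2_mult:
  assumes "f C1_differentiable_on S" "g C1_differentiable_on R" "open S" "open R"
  shows "C_1_on_2 (S \<times> R) (\<lambda>t x. f t * g x)"
proof -
  obtain f' where f': "\<And>t. t \<in> S \<Longrightarrow> (f has_real_derivative f' t) (at t)"
      and f'_cont: "continuous_on S f'"
    using assms(1) unfolding C1_differentiable_on_def has_real_derivative_iff_has_vector_derivative
    by blast
  obtain g' where g': "\<And>x. x \<in> R \<Longrightarrow> (g has_real_derivative g' x) (at x)"
      and g'_cont: "continuous_on R g'"
    using assms(2) unfolding C1_differentiable_on_def has_real_derivative_iff_has_vector_derivative
    by blast
  have f_cont: "continuous_on S f" and g_cont: "continuous_on R g"
    using f' g' by (meson DERIV_isCont continuous_at_imp_continuous_on)+
  show ?thesis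
    unfolding C_1_on_2_def
  proof (intro exI conjI ballI)
    have fst_S: "fst ` (S \<times> R) \<subseteq> S" and snd_R: "snd ` (S \<times> R) \<subseteq> R"
      by auto
    have pull: "continuous_on (S \<times> R) (\<lambda>p. \<phi> (fst p))" if "continuous_on S \<phi>" for \<phi> :: "real \<Rightarrow> real"
      by (rule continuous_on_compose2[OF that _ fst_S]) (intro continuous_intros)
    have pull': "continuous_on (S \<times> R) (\<lambda>p. \<phi> (snd p))" if "continuous_on R \<phi>" for \<phi> :: "real \<Rightarrow> real"
      by (rule continuous_on_compose2[OF that _ snd_R]) (intro continuous_intros)
    show "continuous_on (S \<times> R) (\<lambda>p. f' (fst p) * g (snd p))"
      by (intro continuous_on_mult pull pull' f'_cont g_cont)
    show "continuous_on (S \<times> R) (\<lambda>p. f (fst p) * g' (snd p))"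
      by (intro continuous_on_mult pull pull' f_cont g'_cont)
    fix p assume p: "p \<in> S \<times> R"
    have "((\<lambda>p. f (fst p)) has_derivative (\<lambda>d. f' (fst p) * fst d)) (at p within S \<times> R)"
      using p by (intro has_derivative_compose[OF has_derivative_fst[OF has_derivative_ident]]
          has_field_derivative_imp_has_derivative f') auto
    moreover have "((\<lambda>p. g (snd p)) has_derivative (\<lambda>d. g' (snd p) * snd d)) (at p within S \<times> R)"
      using p by (intro has_derivative_compose[OF has_derivative_snd[OF has_derivative_ident]]
          has_field_derivative_imp_has_derivative g') auto
    ultimately have "((\<lambda>p. f (fst p) * g (snd p)) has_derivative
        (\<lambda>d. f (fst p) * (g' (snd p) * snd d) + f' (fst p) * fst d * g (snd p))) (at p within S \<times> R)"
      by (rule has_derivative_mult)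
    then show "((\<lambda>(t, x). f t * g x) has_derivative
        (\<lambda>(s, y). f' (fst p) * g (snd p) * s + f (fst p) * g' (snd p) * y)) (at p within S \<times> R)"
      by (simp add: case_prod_unfold algebra_simps)
  qed
qed

text \<open>Joint regularity of \<open>h\<close> is inherited from the two products, so only
  one-variable regularity and the pointwise identity remain to be checked.\<close>

lemma weakly_separableI:
  assumes "f1 C1_differentiable_on {T1<..<T2}" "f2 C1_differentiable_on {T1<..<T2}"
    and "g1 C1_differentiable_on R" "g2 C1_differentiable_on R" and "open R"
    and eq: "\<And>t x. t \<in> {T1<..<T2} \<Longrightarrow> x \<in> R \<Longrightarrow> h t x = f1 t * g1 x + f2 t * g2 x"
  shows "weakly_separable h T1 T2 R"
proof -
  let ?A = "{T1<..<T2} \<times> R"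
  obtain a b where ab: "continuous_on ?A a" "continuous_on ?A b"
      "\<And>p. p \<in> ?A \<Longrightarrow> ((\<lambda>(t, x). f1 t * g1 x) has_derivative (\<lambda>(s, y). a p * s + b p * y)) (at p within ?A)"
    using C_1_on_2_mult[OF assms(1,3) _ \<open>open R\<close>] unfolding C_1_on_2_def by auto
  obtain c d where cd: "continuous_on ?A c" "continuous_on ?A d"
      "\<And>p. p \<in> ?A \<Longrightarrow> ((\<lambda>(t, x). f2 t * g2 x) has_derivative (\<lambda>(s, y). c p * s + d p * y)) (at p within ?A)"
    using C_1_on_2_mult[OF assms(2,4) _ \<open>open R\<close>] unfolding C_1_on_2_def by auto
  have "C_1_on_2 ?A h"
    unfolding C_1_on_2_def
  proof (intro exI conjI ballI)
    show "continuous_on ?A (\<lambda>p. a p + c p)" "continuous_on ?A (\<lambda>p. b p + d p)"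
      using ab cd by (auto intro: continuous_on_add)
    fix p assume p: "p \<in> ?A"
    have "((\<lambda>q. (\<lambda>(t, x). f1 t * g1 x) q + (\<lambda>(t, x). f2 t * g2 x) q) has_derivative
        (\<lambda>q. (\<lambda>(s, y). a p * s + b p * y) q + (\<lambda>(s, y). c p * s + d p * y) q)) (at p within ?A)"
      by (intro has_derivative_add ab(3) cd(3) p)
    also have "(\<lambda>q. (\<lambda>(s, y). a p * s + b p * y) q + (\<lambda>(s, y). c p * s + d p * y) q)
        = (\<lambda>(s, y). (a p + c p) * s + (b p + d p) * y)"
      by (auto simp: algebra_simps)
    finally show "((\<lambda>(t, x). h t x) has_derivative
        (\<lambda>(s, y). (a p + c p) * s + (b p + d p) * y)) (at p within ?A)"
      by (rule has_derivative_transform[OF p, rotated]) (auto simp: eq)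
  qed
  then show ?thesis
    unfolding weakly_separable_def C_1_on_open_iff[OF open_greaterThanLessThan] C_1_on_open_iff[OF \<open>open R\<close>]
    using assms by blast
qed

section \<open>Relative derivatives and regularity in time\<close>

lemma has_derivative_D_within:
  assumes "f differentiable_on S" "x \<in> S"
  shows "(f has_real_derivative D_within S f x) (at x within S)"
  using assms unfolding D_within_def differentiable_on_def has_real_derivative_iff_has_vector_derivative
  by (simp add: vector_derivative_works)

lemma has_derivative_D_within_interior:
  assumes "f differentiable_on S" "x \<in> interior S"
  shows "(f has_real_derivative D_within S f x) (at x)"
  using has_derivative_D_within[OF assms(1), of x] assms(2) interior_subset
  by (auto simp: at_within_interior[OF assms(2)])

lemma D_within_eq_interior:
  assumes "(f has_real_derivative d) (at x)" "x \<in> interior S"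
  shows "D_within S f x = d"
  using assms unfolding D_within_def
  by (simp add: at_within_interior[OF assms(2)] vector_derivative_at has_real_derivative_iff_has_vector_derivative)

text \<open>Evaluating a function or its first derivative at \<open>x\<close> is linear and
  continuous for convergence in \<open>C\<^sup>2(S)\<close>, so the curve passes its continuous
  differentiability on to both sections. They later make the time factor \<open>c\<close>
  continuously differentiable.\<close>

lemma C1_into_C2_section:
  assumes "C1_into_C2 {0..T} S u" and x: "x \<in> interior S"
  shows "(\<lambda>t. u t x) C1_differentiable_on {0<..<T}"
    and "(\<lambda>t. D_within S (u t) x) C1_differentiable_on {0<..<T}"
proof -
  obtain v where v: "\<And>t. t \<in> {0..T} \<Longrightarrow> C_k_on 2 S (v t)"
      "\<And>t. t \<in> {0..T} \<Longrightarrow> tendsto_C2 S (\<lambda>s x. (u s x - u t x) / (s - t)) (v t) (at t within {0..T})"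
      "\<And>t. t \<in> {0..T} \<Longrightarrow> tendsto_C2 S v (v t) (at t within {0..T})"
    using assms(1) unfolding C1_into_C2_def by blast
  have diff: "u t differentiable_on S" if "t \<in> {0..T}" for t
    using assms(1) that unfolding C1_into_C2_def by (auto simp: numeral_2_eq_2)
  have pt: "((\<lambda>s. (D_within S ^^ i) (f s) x) \<longlongrightarrow> (D_within S ^^ i) g x) F"
    if "tendsto_C2 S f g F" "i \<le> 2" for f :: "real \<Rightarrow> real \<Rightarrow> real" and g F i
  proof -
    \<comment> \<open>The singleton \<open>{x}\<close> is an admissible compact set, and uniform
      convergence on it is convergence at \<open>x\<close>.\<close>
    have "uniform_limit {x} (\<lambda>s. (D_within S ^^ i) (f s)) ((D_within S ^^ i) g) F"
      using that(1)[unfolded tendsto_C2_def, rule_format, of "{x}" i] that(2) x interior_subset[of S]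
      by auto
    then show ?thesis by (rule tendsto_uniform_limitI) simp
  qed
  have at: "at t within {0..T} = at t" if "t \<in> {0<..<T}" for t
    using that by (intro at_within_interior) simp
  show "(\<lambda>t. u t x) C1_differentiable_on {0<..<T}"
    unfolding C1_differentiable_on_def has_real_derivative_iff_has_vector_derivative[symmetric]
  proof (intro exI conjI ballI)
    fix t assume t: "t \<in> {0<..<T}"
    show "((\<lambda>t. u t x) has_real_derivative v t x) (at t)"
      using pt[OF v(2)[of t], of 0] t by (simp add: at has_field_derivative_iff)
  next
    have "continuous_on {0..T} (\<lambda>t. v t x)"
      using pt[OF v(3), of _ 0] by (simp add: continuous_on_def)
    then show "continuous_on {0<..<T} (\<lambda>t. v t x)"
      by (rule continuous_on_subset) auto
  qed
  show "(\<lambda>t. D_within S (u t) x) C1_differentiable_on {0<..<T}"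
    unfolding C1_differentiable_on_def has_real_derivative_iff_has_vector_derivative[symmetric]
  proof (intro exI conjI ballI)
    fix t assume t: "t \<in> {0<..<T}"
    have "((\<lambda>s. D_within S (\<lambda>x. (u s x - u t x) / (s - t)) x) \<longlongrightarrow> D_within S (v t) x) (at t within {0..T})"
      using pt[OF v(2)[of t], of 1] t by simp
    \<comment> \<open>\<open>D_within\<close> is linear only on differentiable functions.
      Differentiability is known for times in \<open>{0..T}\<close>, which is enough along the
      filter \<open>at t within {0..T}\<close>.\<close>
    then have "((\<lambda>s. (D_within S (u s) x - D_within S (u t) x) / (s - t)) \<longlongrightarrow> D_within S (v t) x)
        (at t within {0..T})"
    proof (rule Lim_transform_eventually)
      show "\<forall>\<^sub>F s in at t within {0..T}. D_within S (\<lambda>x. (u s x - u t x) / (s - t)) x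
          = (D_within S (u s) x - D_within S (u t) x) / (s - t)"
        unfolding eventually_at_filter
      proof (intro always_eventually allI impI)
        fix s assume "s \<noteq> t" "s \<in> {0..T}"
        then show "D_within S (\<lambda>x. (u s x - u t x) / (s - t)) x
          = (D_within S (u s) x - D_within S (u t) x) / (s - t)"
          using t by (intro D_within_eq_interior[OF _ x] DERIV_cdivide DERIV_diff
              has_derivative_D_within_interior[OF _ x] diff) auto
      qed
    qed
    then show "((\<lambda>t. D_within S (u t) x) has_real_derivative D_within S (v t) x) (at t)"
      using t by (simp add: at has_field_derivative_iff)
  next
    have "continuous_on {0..T} (\<lambda>t. D_within S (v t) x)"
      using pt[OF v(3), of _ 1] by (simp add: continuous_on_def)
    then show "continuous_on {0<..<T} (\<lambda>t. D_within S (v t) x)"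
      by (rule continuous_on_subset) auto
  qed
qed

section \<open>The difference of two fluxes\<close>

lemma zero_derivative_imp_const_on_interval:
  fixes f :: "real \<Rightarrow> real"
  assumes "\<And>x. x \<in> {p<..<q} \<Longrightarrow> (f has_real_derivative 0) (at x)"
    and "x \<in> {p<..<q}" "y \<in> {p<..<q}"
  shows "f x = f y"
proof -
  have "\<exists>c. \<forall>x\<in>{p<..<q}. f x = c"
    using assms(1) by (intro has_field_derivative_zero_constant)
      (auto intro: has_field_derivative_at_within)
  then show ?thesis using assms(2,3) by auto
qed

text \<open>Both equations contain the same time derivative, which cancels on subtraction; what
  remains says that \<open>F\<close> has spatial derivative \<open>0\<close>. On an open interval
  inside \<open>D\<close> the relative derivatives are two-sided, and connectedness gives
  constancy.\<close>

lemma flux_independent_of_x: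
  assumes u: "C1_into_C2 {0..T} D u"
    and C1: "C_k_on 1 D \<alpha>" "C_k_on 1 D \<kappa>" "C_k_on 1 D \<alpha>'" "C_k_on 1 D \<kappa>'"
    and eqs: "advection_diffusion T D u \<alpha> \<kappa>" "advection_diffusion T D u \<alpha>' \<kappa>'"
    and sub: "{p<..<q} \<subseteq> D" and t: "t \<in> {0..T}"
    and xy: "x \<in> {p<..<q}" "y \<in> {p<..<q}"
  defines "F \<equiv> \<lambda>x. (\<alpha>' x - \<alpha> x) * u t x - (\<kappa>' x - \<kappa> x) * D_within D (u t) x"
  shows "F x = F y"
proof (rule zero_derivative_imp_const_on_interval[OF _ xy])
  fix z assume "z \<in> {p<..<q}"
  then have z: "z \<in> interior D"
    using sub by (meson interior_maximal open_greaterThanLessThan subsetD)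
  have "C_k_on 2 D (u t)"
    using u t unfolding C1_into_C2_def by blast
  then have ux: "u t differentiable_on D" "D_within D (u t) differentiable_on D"
    by (auto simp: numeral_2_eq_2)
  \<comment> \<open>Every product under a spatial derivative is differentiable, so its
    \<open>D_within\<close> value is a genuine derivative and the difference rule applies.\<close>
  have prod: "((\<lambda>y. f y * g y) has_real_derivative D_within D (\<lambda>y. f y * g y) z) (at z)"
    if "C_k_on 1 D f" "g differentiable_on D" for f g
    using that by (intro has_derivative_D_within_interior[OF _ z] differentiable_on_mult) auto
  have "z \<in> D" using z interior_subset by blast
  then have bal: "D_within D (\<lambda>y. \<alpha>' y * u t y) z - D_within D (\<lambda>y. \<kappa>' y * D_within D (u t) y) z
      - (D_within D (\<lambda>y. \<alpha> y * u t y) z - D_within D (\<lambda>y. \<kappa> y * D_within D (u t) y) z) = 0"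
    using eqs[unfolded advection_diffusion_def, THEN bspec, OF t, THEN bspec, of z] by argo
  have "((\<lambda>y. (\<alpha>' y * u t y - \<kappa>' y * D_within D (u t) y) - (\<alpha> y * u t y - \<kappa> y * D_within D (u t) y))
      has_real_derivative 0) (at z)"
    unfolding bal[symmetric] by (intro DERIV_diff prod ux C1)
  then show "(F has_real_derivative 0) (at z)"
    by (simp add: F_def algebra_simps)
qed

section \<open>Separability from the flux identity\<close>

text \<open>With \<open>g\<close> solving \<open>g' = (a / k) g\<close> and \<open>h\<close> an
  antiderivative of \<open>1 / (k g)\<close>, the equation becomes \<open>(u / g)' = - c h'\<close>.
  Hence \<open>u / g + c h\<close> depends on \<open>t\<close> alone, while \<open>g\<close> and
  \<open>h\<close> depend on \<open>x\<close> alone. Antiderivatives are taken on the closed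
  interval, where continuity of \<open>a\<close> and \<open>k\<close> suffices.\<close>

lemma first_order_linear_separable:
  fixes a k :: "real \<Rightarrow> real"
  assumes a: "continuous_on {p..q} a" and k: "continuous_on {p..q} k"
    and nz: "\<And>x. x \<in> {p..q} \<Longrightarrow> k x \<noteq> 0"
    and ux: "\<And>t x. t \<in> {T1<..<T2} \<Longrightarrow> x \<in> {p<..<q} \<Longrightarrow> (u t has_real_derivative u' t x) (at x)"
    and eq: "\<And>t x. t \<in> {T1<..<T2} \<Longrightarrow> x \<in> {p<..<q} \<Longrightarrow> a x * u t x - k x * u' t x = c t"
    and c: "c C1_differentiable_on {T1<..<T2}"
    and z: "z \<in> {p<..<q}" "(\<lambda>t. u t z) C1_differentiable_on {T1<..<T2}"
  shows "weakly_separable u T1 T2 {p<..<q}"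
proof -
  have at: "at x within {p..q} = at x" if "x \<in> {p<..<q}" for x
    using that by (intro at_within_interior) simp
  have "continuous_on {p..q} (\<lambda>x. a x / k x)"
    using a k nz by (intro continuous_on_divide) auto
  then obtain A where A: "\<And>x. x \<in> {p..q} \<Longrightarrow> (A has_vector_derivative a x / k x) (at x within {p..q})"
    using antiderivative_continuous by blast
  define g where "g x = exp (A x)" for x
  have g': "(g has_real_derivative g x * (a x / k x)) (at x within {p..q})" if "x \<in> {p..q}" for x
    unfolding g_def using A[OF that]
    by (auto simp: has_real_derivative_iff_has_vector_derivative[symmetric] intro!: derivative_eq_intros)
  have g_pos: "g x \<noteq> 0" for x by (simp add: g_def)
  have g_cont: "continuous_on {p..q} g"
    using g' by (rule DERIV_continuous_on)
  have "continuous_on {p..q} (\<lambda>x. 1 / (k x * g x))"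
    using k nz g_cont g_pos by (intro continuous_intros) auto
  then obtain h where h: "\<And>x. x \<in> {p..q} \<Longrightarrow> (h has_vector_derivative 1 / (k x * g x)) (at x within {p..q})"
    using antiderivative_continuous by blast
  have h': "(h has_real_derivative 1 / (k x * g x)) (at x)" if "x \<in> {p<..<q}" for x
    using h[of x] that by (simp add: at has_real_derivative_iff_has_vector_derivative)
  have g'': "(g has_real_derivative g x * (a x / k x)) (at x)" if "x \<in> {p<..<q}" for x
    using g'[of x] that by (simp add: at)
  have g_C1: "g C1_differentiable_on {p<..<q}"
    unfolding C1_differentiable_on_def has_real_derivative_iff_has_vector_derivative[symmetric]
  proof (intro exI conjI ballI)
    have "continuous_on {p..q} (\<lambda>x. g x * (a x / k x))"
      using a k nz g_cont by (intro continuous_intros) auto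
    then show "continuous_on {p<..<q} (\<lambda>x. g x * (a x / k x))"
      by (rule continuous_on_subset) auto
  qed (rule g'')
  have h_C1: "h C1_differentiable_on {p<..<q}"
    unfolding C1_differentiable_on_def has_real_derivative_iff_has_vector_derivative[symmetric]
  proof (intro exI conjI ballI)
    have "continuous_on {p..q} (\<lambda>x. 1 / (k x * g x))"
      using k nz g_cont g_pos by (intro continuous_intros) auto
    then show "continuous_on {p<..<q} (\<lambda>x. 1 / (k x * g x))"
      by (rule continuous_on_subset) auto
  qed (rule h')
  have const: "u t x / g x + c t * h x = u t z / g z + c t * h z"
    if t: "t \<in> {T1<..<T2}" and x: "x \<in> {p<..<q}" for t x
  proof (rule zero_derivative_imp_const_on_interval[OF _ x z(1)])
    fix y assume y: "y \<in> {p<..<q}"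
    have ky: "k y \<noteq> 0" using nz y by auto
    have "((\<lambda>x. u t x / g x + c t * h x) has_real_derivative
        (u' t y * g y - u t y * (g y * (a y / k y))) / (g y * g y) + c t * (1 / (k y * g y))) (at y)"
      by (intro DERIV_add DERIV_cmult DERIV_divide ux g'' h' t y g_pos)
    \<comment> \<open>Replacing \<open>c t\<close> by \<open>a y * u t y - k y * u' t y\<close>
      makes the two summands cancel.\<close>
    also have "(u' t y * g y - u t y * (g y * (a y / k y))) / (g y * g y) + c t * (1 / (k y * g y)) = 0"
      unfolding eq[OF t y, symmetric] using ky g_pos[of y] by (simp add: field_simps)
    finally show "((\<lambda>x. u t x / g x + c t * h x) has_real_derivative 0) (at y)" .
  qed
  show ?thesis
  \<comment> \<open>The base point \<open>z\<close> supplies the integration constant: solving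
    \<open>const\<close> for \<open>u t x\<close> leaves the time factors
    \<open>u t z / g z + c t * h z\<close> and \<open>c t\<close>, with space factors
    \<open>g\<close> and \<open>- h g\<close>.\<close>
  proof (rule weakly_separableI[where ?f2.0 = c and ?g1.0 = g])
    show "(\<lambda>t. u t z * (1 / g z) + c t * h z) C1_differentiable_on {T1<..<T2}"
      using c z(2) by (intro C1_differentiable_on_add C1_differentiable_on_mult) auto
    show "(\<lambda>x. - (h x * g x)) C1_differentiable_on {p<..<q}"
      using g_C1 h_C1 by (intro C1_differentiable_on_minus C1_differentiable_on_mult) auto
    fix t x assume "t \<in> {T1<..<T2}" "x \<in> {p<..<q}"
    from const[OF this] show "u t x = (u t z * (1 / g z) + c t * h z) * g x + c t * - (h x * g x)"
      using g_pos[of x] by (simp add: field_simps)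
  qed (use c g_C1 in auto)
qed

text \<open>Here \<open>u = c / a\<close> is a single product, and the second term of the separable
  form is filled with zeros. The space factor is a reciprocal, so \<open>a\<close> has to be
  continuously differentiable, whereas in the first-order case integration gains the
  derivative.\<close>

lemma zeroth_order_separable:
  fixes a :: "real \<Rightarrow> real"
  assumes a: "a C1_differentiable_on R" and "open R" and nz: "\<And>x. x \<in> R \<Longrightarrow> a x \<noteq> 0"
    and eq: "\<And>t x. t \<in> {T1<..<T2} \<Longrightarrow> x \<in> R \<Longrightarrow> a x * u t x = c t"
    and c: "c C1_differentiable_on {T1<..<T2}"
  shows "weakly_separable u T1 T2 R"
proof (rule weakly_separableI[OF c _ _ _ \<open>open R\<close>])
  show "(\<lambda>x. inverse (a x)) C1_differentiable_on R"
  proof -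
    obtain a' where a': "\<And>x. x \<in> R \<Longrightarrow> (a has_real_derivative a' x) (at x)" "continuous_on R a'"
      using a unfolding C1_differentiable_on_def has_real_derivative_iff_has_vector_derivative by blast
    have "continuous_on R a"
      using a'(1) by (meson DERIV_isCont continuous_at_imp_continuous_on)
    then have "continuous_on R (\<lambda>x. - (inverse (a x) * a' x * inverse (a x)))"
      using a'(2) nz by (intro continuous_intros) auto
    moreover have "((\<lambda>x. inverse (a x)) has_real_derivative - (inverse (a x) * a' x * inverse (a x))) (at x)"
      if "x \<in> R" for x
      by (intro DERIV_inverse' a' that nz)
    ultimately show ?thesis
      unfolding C1_differentiable_on_def has_real_derivative_iff_has_vector_derivative[symmetric]
      by (intro exI[of _ "\<lambda>x. - (inverse (a x) * a' x * inverse (a x))"] conjI ballI)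
  qed
  show "u t x = c t * inverse (a x) + 0 * 0" if "t \<in> {T1<..<T2}" "x \<in> R" for t x
    using eq[OF that] nz[OF that(2)] by (simp add: field_simps)
qed auto

section \<open>Vanishing of the coefficient differences\<close>

lemma closed_interval_in_open:
  fixes x :: real
  assumes "open S" "x \<in> S"
  obtains p q where "p < q" "x \<in> {p<..<q}" "{p..q} \<subseteq> S"
proof -
  obtain e where "e > 0" "cball x e \<subseteq> S"
    using assms open_contains_cball by blast
  then show ?thesis
    by (intro that[of "x - e" "x + e"]) (auto simp: cball_eq_atLeastAtMost)
qed

theorem theorem3p7:
  fixes D :: "real set" and T :: real
    and u :: "real \<Rightarrow> real \<Rightarrow> real"
    and \<alpha> \<kappa> :: "real \<Rightarrow> real"
  assumes "is_interval D" and "interior D \<noteq> {}" and "T > 0"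
    and "C1_into_C2 {0..T} D u"
    and "C_k_on 1 D \<alpha>" and "C_k_on 1 D \<kappa>"
    and "advection_diffusion T D u \<alpha> \<kappa>"
    and "\<not> (\<exists>\<Omega> T1 T2. open \<Omega> \<and> is_interval \<Omega> \<and> \<Omega> \<noteq> {} \<and> \<Omega> \<subseteq> D \<and>
            T1 < T2 \<and> {T1<..<T2} \<subseteq> {0<..T} \<and> weakly_separable u T1 T2 \<Omega>)"
  shows "\<forall>\<alpha>' \<kappa>'. C_k_on 1 D \<alpha>' \<and> C_k_on 1 D \<kappa>' \<and> advection_diffusion T D u \<alpha>' \<kappa>' \<longrightarrow>
           (\<forall>x\<in>D. \<alpha>' x = \<alpha> x \<and> \<kappa>' x = \<kappa> x)"
proof (intro allI impI)
  fix \<alpha>' \<kappa>' assume prime: "C_k_on 1 D \<alpha>' \<and> C_k_on 1 D \<kappa>' \<and> advection_diffusion T D u \<alpha>' \<kappa>'"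
  define a where "a x = \<alpha>' x - \<alpha> x" for x
  define k where "k x = \<kappa>' x - \<kappa> x" for x
  \<comment> \<open>The flux difference is constant on open intervals in \<open>D\<close>, so its
    value at a reference point \<open>z\<close> serves as the time-dependent constant. This explicit
    formula gives its regularity in \<open>t\<close>.\<close>
  define c where "c z t = a z * u t z - k z * D_within D (u t) z" for z t
  \<comment> \<open>The hypothesis is applied on the whole open time interval, with
    \<open>T1 = 0\<close> and \<open>T2 = T\<close>.\<close>
  have nonsep: "\<not> weakly_separable u 0 T {p<..<q}" if "p < q" "{p<..<q} \<subseteq> D" for p q
    using assms(8) that \<open>T > 0\<close>
    by (metis greaterThanLessThan_empty_iff greaterThanLessThan_subseteq_greaterThanAtMost_iff
        is_interval_oo leD open_greaterThanLessThan order_refl)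
  have a_diff: "a differentiable_on D" and k_diff: "k differentiable_on D"
    unfolding a_def k_def using assms(5,6) prime by (auto intro!: differentiable_on_diff)
  then have cont: "continuous_on D a" "continuous_on D k"
    by (auto intro: differentiable_imp_continuous_on)
  have c_C1: "c z C1_differentiable_on {0<..<T}" if "z \<in> interior D" for z
    unfolding c_def using C1_into_C2_section[OF assms(4) that]
    by (intro C1_differentiable_on_diff C1_differentiable_on_mult) auto
  have flux: "a x * u t x - k x * D_within D (u t) x = c z t"
    if "{p<..<q} \<subseteq> D" "t \<in> {0<..<T}" "x \<in> {p<..<q}" "z \<in> {p<..<q}" for p q t x z
    using flux_independent_of_x[OF assms(4-6) _ _ assms(7) _ that(1) _ that(3,4), of \<alpha>' \<kappa>' t] prime that(2)
    by (simp add: a_def k_def c_def)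
  \<comment> \<open>This precedes the claim on \<open>a\<close>, whose proof uses that
    \<open>k\<close> vanishes on the interior. By continuity \<open>k\<close> stays nonzero on a
    closed interval around \<open>z\<close>, where \<open>a / k\<close> is continuous and the
    first-order case applies.\<close>
  have k0: "k z = 0" if z: "z \<in> interior D" for z
  proof (rule ccontr)
    assume "k z \<noteq> 0"
    moreover have "open (interior D \<inter> k -` (- {0}))"
      by (intro continuous_open_preimage continuous_on_subset[OF cont(2) interior_subset]) auto
    ultimately obtain p q where pq: "p < q" "z \<in> {p<..<q}" "{p..q} \<subseteq> interior D \<inter> k -` (- {0})"
      using z by (metis ComplI IntI closed_interval_in_open singletonD vimageI)
    have sub: "{p..q} \<subseteq> D" using pq(3) interior_subset by blast
    have sub': "{p<..<q} \<subseteq> {p..q}" by auto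
    have "weakly_separable u 0 T {p<..<q}"
    proof (rule first_order_linear_separable[where c = "c z" and u' = "\<lambda>t. D_within D (u t)"])
      show "k x \<noteq> 0" if "x \<in> {p..q}" for x using pq(3) that by auto
      show "(u t has_real_derivative D_within D (u t) x) (at x)" if "t \<in> {0<..<T}" "x \<in> {p<..<q}" for t x
        using assms(4) that pq(3) sub' unfolding C1_into_C2_def
        by (intro has_derivative_D_within_interior) (auto simp: numeral_2_eq_2)
      show "a x * u t x - k x * D_within D (u t) x = c z t" if "t \<in> {0<..<T}" "x \<in> {p<..<q}" for t x
        using flux that pq(2) sub sub' by (meson subset_trans)
    qed (use pq z sub cont c_C1 C1_into_C2_section[OF assms(4)] in \<open>auto intro: continuous_on_subset\<close>)
    then show False using nonsep[of p q] pq(1) sub sub' by auto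
  qed
  \<comment> \<open>Since \<open>k\<close> vanishes on the interior, the flux identity reduces to
    \<open>a x * u t x = c z t\<close>, and a nonzero \<open>a z\<close> would lead to the
    zeroth-order case near \<open>z\<close>.\<close>
  have a0: "a z = 0" if z: "z \<in> interior D" for z
  proof (rule ccontr)
    assume "a z \<noteq> 0"
    moreover have "open (interior D \<inter> a -` (- {0}))"
      by (intro continuous_open_preimage continuous_on_subset[OF cont(1) interior_subset]) auto
    ultimately obtain p q where pq: "p < q" "z \<in> {p<..<q}" "{p..q} \<subseteq> interior D \<inter> a -` (- {0})"
      using z by (metis ComplI IntI closed_interval_in_open singletonD vimageI)
    have sub: "{p<..<q} \<subseteq> D" "{p<..<q} \<subseteq> interior D"
      using pq(3) interior_subset[of D] by (auto simp: subset_eq)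
    \<comment> \<open>On an open interval inside \<open>D\<close> the relative derivative is
      two-sided, which turns \<open>C_k_on 1 D\<close> into
      \<open>C1_differentiable_on\<close>.\<close>
    have C1: "f C1_differentiable_on {p<..<q}" if "C_k_on 1 D f" for f
      unfolding C1_differentiable_on_def has_real_derivative_iff_has_vector_derivative[symmetric]
      using that sub by (intro exI[of _ "D_within D f"])
        (auto intro!: has_derivative_D_within_interior intro: continuous_on_subset)
    have "weakly_separable u 0 T {p<..<q}"
    proof (rule zeroth_order_separable[where c = "c z"])
      show "a C1_differentiable_on {p<..<q}"
        unfolding a_def using C1 assms(5) prime by (intro C1_differentiable_on_diff) auto
      show "a x \<noteq> 0" if "x \<in> {p<..<q}" for x
        using subsetD[OF pq(3), of x] that by auto
      show "a x * u t x = c z t" if "t \<in> {0<..<T}" "x \<in> {p<..<q}" for t x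
        using flux[OF sub(1) that pq(2)] k0 that(2) sub(2) by auto
    qed (use c_C1 z in auto)
    then show False using nonsep[OF pq(1) sub(1)] by auto
  qed
  \<comment> \<open>For an interval with nonempty interior, endpoints belonging to \<open>D\<close>
    are limits of interior points, so the vanishing of \<open>a\<close> and \<open>k\<close> extends
    to them by continuity.\<close>
  have "D \<subseteq> closure (interior D)"
    using convex_closure_interior[of D] assms(1,2) closure_subset
    by (simp add: is_interval_convex_1)
  show "\<forall>x\<in>D. \<alpha>' x = \<alpha> x \<and> \<kappa>' x = \<kappa> x"
  proof
    fix x assume x: "x \<in> D"
    have zero: "f x = 0" if "continuous_on D f" "\<And>z. z \<in> interior D \<Longrightarrow> f z = 0" for f :: "real \<Rightarrow> real"
    proof -
      have "x \<in> closure (interior D)" using x \<open>D \<subseteq> closure (interior D)\<close> by blast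
      then obtain s where s: "\<And>n. s n \<in> interior D" "s \<longlonglongrightarrow> x"
        unfolding closure_sequential by blast
      have "(\<lambda>n. f (s n)) \<longlonglongrightarrow> f x"
        using s x interior_subset by (intro continuous_on_tendsto_compose[OF that(1)]) (auto intro!: always_eventually)
      moreover have "(\<lambda>n. f (s n)) \<longlonglongrightarrow> 0" using that(2) s(1) by simp
      ultimately show ?thesis by (rule LIMSEQ_unique)
    qed
    show "\<alpha>' x = \<alpha> x \<and> \<kappa>' x = \<kappa> x"
      using zero[OF cont(1) a0] zero[OF cont(2) k0] by (simp add: a_def k_def)
  qed
qed

end
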